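(* Let $q$ be a prime power. Then $$\lim_{n\to\infty}\ \frac{1}{q^{n^2}}\sum_{r=0}^{n}\left(\genfrac{[}{]}{0pt}{}{n}{r}_{q}\right)^{2} q^{-r}\prod_{i=0}^{r-1}(q^r-q^i)=0.$$
   Context: The $q$-binomial coefficient is $\genfrac{[}{]}{0pt}{}{n}{r}_{q}=\prod_{i=0}^{r-1}(q^n-q^i)\big/\prod_{i=0}^{r-1}(q^r-q^i)$, with empty products equal to $1$. *)

theory Defs
  imports Complex_Main "HOL-Number_Theory.Prime_Powers"
begin

definition q_binomial :: "real \<Rightarrow> nat \<Rightarrow> nat \<Rightarrow> real" where
  "q_binomial q n r = (\<Prod>i<r. q ^ n - q ^ i) / (\<Prod>i<r. q ^ r - q ^ i)"

end

theory Submission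
  imports Defs
begin

text \<open>
  The summand without the factor \<open>q\<^sup>-\<^sup>r\<close> is the number of \<open>n \<times> n\<close> matrices of rank \<open>r\<close>
  over the field with \<open>q\<close> elements, so the expression is the expected value of
  \<open>q\<^sup>-\<^sup>r\<^sup>a\<^sup>n\<^sup>k\<close> for a uniformly random matrix. Almost all such matrices have rank close to \<open>n\<close>,
  which is why the limit is \<open>0\<close>.

  The counting interpretation is only a guide; the estimate works with the formula itself.
  After cancellation the \<open>r\<close>-th summand is \<open>q\<^sup>-\<^sup>r A\<^sup>2 / P\<close>, where \<open>A\<close> is a product of \<open>r\<close> factors
  at most \<open>q\<^sup>n\<close>, and \<open>P\<close> is the order of \<open>GL\<^sub>r\<close>. The decisive point is that \<open>P\<close> is at least a
  fixed proportion, here a quarter, of \<open>q\<^bsup>r\<^sup>2\<^esup>\<close> (lemma \<open>order_GL_lower_bound\<close>). Division by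
  \<open>q\<^bsup>n\<^sup>2\<^esup>\<close> then leaves at most \<open>4\<close> times the power of \<open>q\<close> with exponent
  \<open>- (n - r)\<^sup>2 - r \<le> - n\<close> (lemma \<open>rank_term_bound\<close>). There are \<open>n + 1\<close> summands, so the
  whole expression is at most \<open>4 (n + 1) / q\<^sup>n\<close>.
\<close>

text \<open>
  Passing from \<open>r\<close> to \<open>r + 1\<close> splits off the factor for \<open>i = 0\<close>; each remaining factor
  contains one more \<open>q\<close>.
\<close>

lemma order_GL_Suc:
  fixes q :: real
  shows "(\<Prod>i<Suc r. q ^ Suc r - q ^ i) = (q ^ Suc r - 1) * q ^ r * (\<Prod>i<r. q ^ r - q ^ i)"
proof -
  have "(\<Prod>i<Suc r. q ^ Suc r - q ^ i) = (q ^ Suc r - 1) * (\<Prod>i<r. q * (q ^ r - q ^ i))"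
    unfolding prod.lessThan_Suc_shift by (simp add: algebra_simps)
  also have "\<dots> = (q ^ Suc r - 1) * q ^ r * (\<Prod>i<r. q ^ r - q ^ i)"
    by (simp only: prod.distrib) simp
  finally show ?thesis .
qed

text \<open>
  Divided by \<open>q\<^bsup>r\<^sup>2\<^esup>\<close>, the order of \<open>GL\<^sub>r\<close> is the product of the \<open>1 - q\<^sup>-\<^sup>j\<close> for
  \<open>1 \<le> j \<le> r\<close>, which has to stay above \<open>1/4\<close>. A constant
  bound does not survive multiplication by one more such factor, so the induction carries the
  vanishing surplus \<open>1 / (2 q\<^sup>r)\<close>. For \<open>q = 2\<close> the step needs \<open>q\<^sup>r \<ge> 2\<close>; hence the induction
  starts at \<open>r = 1\<close>.
\<close>

lemma order_GL_lower_bound_surplus: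
  fixes q :: real
  assumes q: "q \<ge> 2"
  shows "(\<Prod>i<Suc r. q ^ Suc r - q ^ i) \<ge> q ^ ((Suc r)\<^sup>2) * (1 / 4 + 1 / (2 * q ^ Suc r))"
proof (induction r)
  case 0
  show ?case using q by (simp add: field_simps)
next
  case (Suc r)
  define s where "s = Suc r"
  define y where "y = q ^ s"
  define P where "P = (\<Prod>i<s. q ^ s - q ^ i)"
  have "q ^ 1 \<le> q ^ s"
    using q by (intro power_increasing) (auto simp: s_def)
  then have y: "y \<ge> q" by (simp add: y_def)
  have IH: "P \<ge> q ^ s\<^sup>2 * (1 / 4 + 1 / (2 * y))"
    using Suc.IH by (simp add: P_def y_def s_def)
  have exp: "q ^ (Suc s)\<^sup>2 = q ^ s\<^sup>2 * (y * y * q)"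
    by (simp add: y_def power2_eq_square power_add algebra_simps)
  have key: "y * y * q * (1 / 4 + 1 / (2 * (q * y))) \<le> (q * y - 1) * y * (1 / 4 + 1 / (2 * y))"
  proof -
    have "0 \<le> 2 * ((q - 2) * y) + (y - 2)" using q y by simp
    moreover have "(q * y - 1) * y * (1 / 4 + 1 / (2 * y)) - y * y * q * (1 / 4 + 1 / (2 * (q * y)))
        = (2 * ((q - 2) * y) + (y - 2)) / 4"
      using q y by (simp add: field_simps)
    ultimately show ?thesis by simp
  qed
  have "q ^ (Suc s)\<^sup>2 * (1 / 4 + 1 / (2 * q ^ Suc s))
      = q ^ s\<^sup>2 * (y * y * q * (1 / 4 + 1 / (2 * (q * y))))"
    unfolding exp by (simp add: y_def)
  also have "\<dots> \<le> q ^ s\<^sup>2 * ((q * y - 1) * y * (1 / 4 + 1 / (2 * y)))"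
    using key q by (intro mult_left_mono) auto
  also have "\<dots> = (q * y - 1) * y * (q ^ s\<^sup>2 * (1 / 4 + 1 / (2 * y)))"
    by simp
  also have "\<dots> \<le> (q * y - 1) * y * P"
  proof (intro mult_left_mono IH mult_nonneg_nonneg)
    have "1 * 1 \<le> q * y" using q y by (intro mult_mono) auto
    then show "0 \<le> q * y - 1" by simp
  qed (use q y in auto)
  also have "\<dots> = (\<Prod>i<Suc s. q ^ Suc s - q ^ i)"
    unfolding order_GL_Suc P_def y_def by simp
  finally show ?case by (simp only: s_def)
qed

lemma order_GL_lower_bound:
  fixes q :: real
  assumes q: "q \<ge> 2"
  shows "(\<Prod>i<r. q ^ r - q ^ i) \<ge> q ^ r\<^sup>2 / 4"
proof (cases r)
  case 0
  then show ?thesis by simp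
next
  case (Suc s)
  have "q ^ r\<^sup>2 / 4 \<le> q ^ r\<^sup>2 * (1 / 4 + 1 / (2 * q ^ r))"
    using q by (simp add: algebra_simps)
  also have "\<dots> \<le> (\<Prod>i<r. q ^ r - q ^ i)"
    using order_GL_lower_bound_surplus[OF q, of s] by (simp only: Suc)
  finally show ?thesis .
qed

text \<open>
  The bound does not depend on \<open>r\<close>: low ranks are rare, and high ranks have a small weight
  \<open>q\<^sup>-\<^sup>r\<close>. In exponents this is \<open>(n - r)\<^sup>2 + r \<ge> n\<close>.
\<close>

lemma rank_term_bound:
  fixes q :: real
  assumes q: "q \<ge> 2" and r: "r \<le> n"
  shows "(q_binomial q n r)\<^sup>2 * q powi (- int r) * (\<Prod>i<r. q ^ r - q ^ i) \<le> 4 * q ^ n\<^sup>2 / q ^ n"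
proof -
  define A where "A = (\<Prod>i<r. q ^ n - q ^ i)"
  define P where "P = (\<Prod>i<r. q ^ r - q ^ i)"
  have P: "P \<ge> q ^ r\<^sup>2 / 4"
    unfolding P_def by (rule order_GL_lower_bound[OF q])
  have "0 < q ^ r\<^sup>2 / 4" using q by simp
  with P have P_pos: "P > 0" by linarith
  have A0: "A \<ge> 0"
    unfolding A_def using q r by (intro prod_nonneg) (auto intro!: power_increasing)
  have "A \<le> (\<Prod>i<r. q ^ n)"
    unfolding A_def using q r by (intro prod_mono) (auto intro!: power_increasing)
  then have A: "A \<le> q ^ (n * r)" by (simp add: power_mult)
  have exponents: "2 * (n * r) + n \<le> n\<^sup>2 + r\<^sup>2 + r"
  proof -
    obtain d where d: "n = r + d" using r le_Suc_ex by blast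
    have "d \<le> d * d" by (cases d) auto
    then show ?thesis by (simp add: d power2_eq_square algebra_simps)
  qed
  have "(q_binomial q n r)\<^sup>2 * q powi (- int r) * P = A\<^sup>2 / (P * q ^ r)"
    using P_pos q unfolding q_binomial_def A_def[symmetric] P_def[symmetric]
    by (simp add: power_int_minus field_simps power2_eq_square)
  also have "\<dots> \<le> (q ^ (n * r))\<^sup>2 / (q ^ r\<^sup>2 / 4 * q ^ r)"
    using A A0 P q by (intro frac_le power_mono mult_right_mono) auto
  also have "\<dots> = 4 * q ^ (2 * (n * r)) / (q ^ (r\<^sup>2 + r))"
    by (simp add: power_add power_mult[symmetric] mult.commute)
  also have "\<dots> \<le> 4 * q ^ n\<^sup>2 / q ^ n"
  proof -
    have "q ^ (2 * (n * r) + n) \<le> q ^ (n\<^sup>2 + r\<^sup>2 + r)"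
      using exponents q by (intro power_increasing) auto
    then show ?thesis using q by (simp add: power_add field_simps)
  qed
  finally show ?thesis unfolding P_def .
qed

theorem proposition4p24:
  fixes q :: nat
  assumes "primepow q"
  shows "(\<lambda>n. 1 / real q ^ (n\<^sup>2) *
           (\<Sum>r\<le>n. (q_binomial (real q) n r)\<^sup>2 * real q powi (- int r) *
              (\<Prod>i<r. real q ^ r - real q ^ i))) \<longlonglongrightarrow> 0"
    (is "?f \<longlonglongrightarrow> 0")
proof (rule tendsto_sandwich[OF _ _ tendsto_const])
  have q: "real q \<ge> 2"
    using primepow_gt_Suc_0[OF assms] by simp
  show "\<forall>\<^sub>F n in sequentially. 0 \<le> ?f n"
  proof (intro always_eventually allI mult_nonneg_nonneg sum_nonneg)
    fix n r
    have "0 \<le> real q ^ r\<^sup>2 / 4" by simp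
    also have "\<dots> \<le> (\<Prod>i<r. real q ^ r - real q ^ i)"
      by (rule order_GL_lower_bound[OF q])
    finally show "0 \<le> (\<Prod>i<r. real q ^ r - real q ^ i)" .
  qed auto
  show "\<forall>\<^sub>F n in sequentially. ?f n \<le> 4 * (real n * (1 / real q) ^ n + (1 / real q) ^ n)"
  proof (intro always_eventually allI)
    fix n
    have "(\<Sum>r\<le>n. (q_binomial (real q) n r)\<^sup>2 * real q powi (- int r) *
              (\<Prod>i<r. real q ^ r - real q ^ i)) \<le> (\<Sum>r\<le>n. 4 * real q ^ n\<^sup>2 / real q ^ n)"
      by (intro sum_mono rank_term_bound[OF q]) simp
    then have "?f n \<le> 1 / real q ^ (n\<^sup>2) * (\<Sum>r\<le>n. 4 * real q ^ n\<^sup>2 / real q ^ n)"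
      by (intro mult_left_mono) auto
    also have "\<dots> = 4 * (real n * (1 / real q) ^ n + (1 / real q) ^ n)"
      using q by (simp add: power_one_over field_simps)
    finally show "?f n \<le> 4 * (real n * (1 / real q) ^ n + (1 / real q) ^ n)" .
  qed
  have "(\<lambda>n. 4 * (real n * (1 / real q) ^ n + (1 / real q) ^ n)) \<longlonglongrightarrow> 4 * (0 + 0)"
    using q by (intro tendsto_intros powser_times_n_limit_0 LIMSEQ_power_zero) auto
  then show "(\<lambda>n. 4 * (real n * (1 / real q) ^ n + (1 / real q) ^ n)) \<longlonglongrightarrow> 0"
    by simp
qed

end
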